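(* Let $\mathbb{V}=\mathbb{R}^{2n}$ and let $\dot x=X_H(x)+X_F(x)$ be a dissipative Hamiltonian system on $\mathbb{V}$. Let $M$ be a closed subset of $\mathbb{V}$ such that for every initial condition $x_0\in M$ the solution $x(t)$ with $x(0)=x_0$ exists and lies in $M$ for every $t\ge0$, and let $H_M:M\to\mathbb{R}$ be the restriction of the Hamiltonian function $H$ to $M$. If $x_*\in M$ is a strict local minimum of $H_M$ in $M$, then $x_*$ is a stable equilibrium for the dissipative Hamiltonian system (considered on $M$).
   Context: For smooth $H:\mathbb{V}\to\mathbb{R}$, $x=(q,p)$, the Hamiltonian vector field is $X_H(x)=(\nabla_pH(x),-\nabla_qH(x))$. A vertical vector field is one of the form $X_F(x)=(0,f_H(x))$ with $f_H:\mathbb{V}\to\mathbb{R}^n$. A vertical vector field $X_F$ is dissipative if $dH\cdot X_F|_x\le0$ for every $x\in\mathbb{V}$; the system $\dot x=X_H(x)+X_F(x)$ is dissipative if $X_F$ is a dissipative vertical vector field. $M$ carries the subspace topology. An equilibrium point $x_*$ is (Lyapunov) stable if for every neighbourhood $U$ of $x_*$ (in $M$) there is a neighbourhood $V\subset U$ of $x_*$ (in $M$) such that $x_0\in V$ implies $x(t)\in U$ for every $t\ge0$. Strict local minimum means $H_M(x)>H_M(x_* )$ for all $x\neq x_*$ in some neighbourhood of $x_*$ in $M$. *)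

theory Defs
  imports "HOL-Analysis.Analysis"
begin

fun C_k :: "nat \<Rightarrow> ('a::euclidean_space \<Rightarrow> real) \<Rightarrow> bool" where
  "C_k 0 f \<longleftrightarrow> continuous_on UNIV f"
| "C_k (Suc k) f \<longleftrightarrow>
     (\<forall>x. f differentiable (at x)) \<and>
     (\<forall>b\<in>Basis. C_k k (\<lambda>x. frechet_derivative f (at x) b))"

definition smooth :: "('a::euclidean_space \<Rightarrow> real) \<Rightarrow> bool" where
  "smooth f \<longleftrightarrow> (\<forall>k. C_k k f)"

definition gradient :: "('a::real_inner \<Rightarrow> real) \<Rightarrow> 'a \<Rightarrow> 'a" where
  "gradient f x = (THE D. GDERIV f x :> D)"

text \<open>The phase space $R^{2n}$ is the product of positions \<open>q\<close> and momenta \<open>p\<close>.\<close>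

type_synonym 'n phase = "(real ^ 'n) \<times> (real ^ 'n)"

definition grad_q :: "('n::finite phase \<Rightarrow> real) \<Rightarrow> 'n phase \<Rightarrow> real ^ 'n" where
  "grad_q H x = gradient (\<lambda>q. H (q, snd x)) (fst x)"

definition grad_p :: "('n::finite phase \<Rightarrow> real) \<Rightarrow> 'n phase \<Rightarrow> real ^ 'n" where
  "grad_p H x = gradient (\<lambda>p. H (fst x, p)) (snd x)"

definition hamiltonian_vf :: "('n::finite phase \<Rightarrow> real) \<Rightarrow> 'n phase \<Rightarrow> 'n phase" where
  "hamiltonian_vf H x = (grad_p H x, - grad_q H x)"

definition vertical_vf :: "('n::finite phase \<Rightarrow> 'n phase) \<Rightarrow> bool" where
  "vertical_vf X \<longleftrightarrow> (\<exists>f :: 'n phase \<Rightarrow> real ^ 'n. \<forall>x. X x = (0, f x))"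

definition dissipative_vf :: "('n::finite phase \<Rightarrow> real) \<Rightarrow> ('n phase \<Rightarrow> 'n phase) \<Rightarrow> bool" where
  "dissipative_vf H X \<longleftrightarrow>
     vertical_vf X \<and> (\<forall>x. frechet_derivative H (at x) (X x) \<le> 0)"

definition forward_solution ::
    "('a::real_normed_vector \<Rightarrow> 'a) \<Rightarrow> 'a \<Rightarrow> (real \<Rightarrow> 'a) \<Rightarrow> bool" where
  "forward_solution X x0 x \<longleftrightarrow>
     x 0 = x0 \<and> (\<forall>t\<ge>0. (x has_vector_derivative X (x t)) (at t within {0..}))"

text \<open>No regularity of the vector field is imposed, so solutions need not be unique; ``the
  solution'' starting at a point is read as: a solution exists, and the claim holds for every
  solution. For a locally Lipschitz field this is the usual unique solution.\<close>

definition forward_invariant :: "('a::real_normed_vector \<Rightarrow> 'a) \<Rightarrow> 'a set \<Rightarrow> bool" where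
  "forward_invariant X M \<longleftrightarrow>
     (\<forall>x0\<in>M. (\<exists>x. forward_solution X x0 x) \<and>
              (\<forall>x. forward_solution X x0 x \<longrightarrow> (\<forall>t\<ge>0. x t \<in> M)))"

definition nbhd_in :: "'a::topological_space set \<Rightarrow> 'a \<Rightarrow> 'a set \<Rightarrow> bool" where
  "nbhd_in M x U \<longleftrightarrow> U \<subseteq> M \<and> (\<exists>W. openin (top_of_set M) W \<and> x \<in> W \<and> W \<subseteq> U)"

definition strict_local_min_in :: "'a::topological_space set \<Rightarrow> ('a \<Rightarrow> real) \<Rightarrow> 'a \<Rightarrow> bool" where
  "strict_local_min_in M h xs \<longleftrightarrow>
     (\<exists>U. nbhd_in M xs U \<and> (\<forall>x\<in>U. x \<noteq> xs \<longrightarrow> h x > h xs))"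

definition equilibrium :: "('a::real_normed_vector \<Rightarrow> 'a) \<Rightarrow> 'a \<Rightarrow> bool" where
  "equilibrium X xs \<longleftrightarrow> X xs = 0"

definition stable_equilibrium_in ::
    "'a::real_normed_vector set \<Rightarrow> ('a \<Rightarrow> 'a) \<Rightarrow> 'a \<Rightarrow> bool" where
  "stable_equilibrium_in M X xs \<longleftrightarrow>
     equilibrium X xs \<and>
     (\<forall>U. nbhd_in M xs U \<longrightarrow>
        (\<exists>V. nbhd_in M xs V \<and> V \<subseteq> U \<and>
             (\<forall>x0\<in>V. \<forall>x. forward_solution X x0 x \<longrightarrow> (\<forall>t\<ge>0. x t \<in> U))))"

end

theory Submission
  imports Defs
begin

text \<open>The Hamiltonian part of the field is tangent to the level sets of \<open>H\<close>, so \<open>H\<close> does not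
  increase along solutions and serves as a Lyapunov function. A solution starting at \<open>xs\<close> stays in
  \<open>M\<close> below the level \<open>H xs\<close>, so strictness keeps it at \<open>xs\<close> for a short time and the field
  vanishes there. For stability, \<open>M\<close> meets a small sphere around \<open>xs\<close> in a compact set, on which
  \<open>H\<close> has a minimum exceeding \<open>H xs\<close>; solutions starting inside the sphere below that minimum
  cannot cross it.\<close>

text \<open>Riesz representation: the vector \<open>g\<close> with coordinates \<open>D b\<close>
  represents \<open>D\<close>. Uniqueness of the derivative makes it the only candidate, so the
  definite description in \<open>gradient\<close> is well defined.\<close>

lemma inner_gradient:
  fixes f :: "'a::euclidean_space \<Rightarrow> real"
  assumes "(f has_derivative D) (at x)"
  shows "h \<bullet> gradient f x = D h"
proof -
  have lin: "linear D"
    using assms has_derivative_linear by blast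
  define g where "g = (\<Sum>b\<in>Basis. D b *\<^sub>R b)"
  have g: "D h = h \<bullet> g" for h
  proof -
    have "D h = D (\<Sum>b\<in>Basis. (h \<bullet> b) *\<^sub>R b)"
      by (simp add: euclidean_representation)
    also have "\<dots> = h \<bullet> g"
      by (simp add: g_def linear_sum[OF lin] linear_scale[OF lin] inner_sum_right mult.commute)
    finally show ?thesis .
  qed
  have "gradient f x = g"
    unfolding gradient_def
  proof (rule the_equality)
    show "GDERIV f x :> g"
      using assms by (simp add: gderiv_def flip: g)
  next
    fix g' assume "GDERIV f x :> g'"
    then have "(\<lambda>h. h \<bullet> g') = D"
      using assms has_derivative_unique unfolding gderiv_def by blast
    then have "\<forall>h. h \<bullet> g' = h \<bullet> g"
      using g by metis
    then show "g' = g"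
      by (simp only: vector_eq_ldot)
  qed
  then show ?thesis
    using g by simp
qed

text \<open>By linearity \<open>D\<close> splits into its restrictions to the two factors. By the
  chain rule these are the derivatives of \<open>H\<close> with one of the two variables
  frozen.\<close>

lemma derivative_eq_partial_gradients:
  fixes H :: "'n::finite phase \<Rightarrow> real"
  assumes "(H has_derivative D) (at x)"
  shows "D (u, v) = u \<bullet> grad_q H x + v \<bullet> grad_p H x"
proof -
  have D: "(H has_derivative D) (at (fst x, snd x))"
    using assms by simp
  have "((\<lambda>q. H (q, snd x)) has_derivative (\<lambda>h. D (h, 0))) (at (fst x))"
    by (rule has_derivative_compose[where f = "\<lambda>q. (q, snd x)", OF _ D])
      (auto intro!: derivative_eq_intros)
  then have q: "u \<bullet> grad_q H x = D (u, 0)"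
    unfolding grad_q_def by (rule inner_gradient)
  have "((\<lambda>p. H (fst x, p)) has_derivative (\<lambda>h. D (0, h))) (at (snd x))"
    by (rule has_derivative_compose[where f = "\<lambda>p. (fst x, p)", OF _ D])
      (auto intro!: derivative_eq_intros)
  then have p: "v \<bullet> grad_p H x = D (0, v)"
    unfolding grad_p_def by (rule inner_gradient)
  have "D (u, v) = D ((u, 0) + (0, v))"
    by simp
  also have "\<dots> = D (u, 0) + D (0, v)"
    using assms has_derivative_linear linear_add by blast
  finally show ?thesis
    using p q by simp
qed

text \<open>Conservation of energy: the position and momentum terms are the same inner product of
  the partial gradients with opposite signs.\<close>

lemma derivative_hamiltonian_vf:
  fixes H :: "'n::finite phase \<Rightarrow> real"
  assumes "(H has_derivative D) (at x)"
  shows "D (hamiltonian_vf H x) = 0"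
  unfolding hamiltonian_vf_def derivative_eq_partial_gradients[OF assms]
  by (simp add: inner_commute)

lemma forward_solution_continuous_on:
  assumes "forward_solution X x0 x"
  shows "continuous_on {0..} x"
  using assms unfolding forward_solution_def
  by (auto simp: continuous_on_eq_continuous_within intro: has_vector_derivative_continuous)

text \<open>The chain rule gives \<open>H\<close> along the solution the derivative
  \<open>D (x s) (X (x s))\<close>, which is nonpositive, and the mean value theorem turns this into
  a comparison of endpoint values.\<close>

lemma nonincreasing_along_forward_solution:
  fixes H :: "'a::real_normed_vector \<Rightarrow> real"
  assumes sol: "forward_solution X x0 x"
    and H: "\<And>y. (H has_derivative D y) (at y)"
    and D: "\<And>y. D y (X y) \<le> 0"
    and t: "0 \<le> t"
  shows "H (x t) \<le> H x0"
proof (cases "t = 0")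
  case True
  then show ?thesis
    using sol by (simp add: forward_solution_def)
next
  case False
  have der: "((\<lambda>s. H (x s)) has_derivative (\<lambda>h. D (x s) (h *\<^sub>R X (x s)))) (at s within {0..t})"
    if "s \<in> {0..t}" for s
  proof -
    have "(x has_derivative (\<lambda>h. h *\<^sub>R X (x s))) (at s within {0..t})"
      using sol that unfolding forward_solution_def has_vector_derivative_def
      by (auto intro: has_derivative_subset[where s = "{0..}"])
    then show ?thesis
      using H by (rule has_derivative_compose)
  qed
  obtain s where s: "H (x t) - H (x 0) = D (x s) ((t - 0) *\<^sub>R X (x s))"
    using mvt_simple[OF _ der] False t by force
  also have "\<dots> = t * D (x s) (X (x s))"
    using linear_scale[OF has_derivative_linear[OF H]] by simp
  also have "\<dots> \<le> 0"
    using t D by (simp add: mult_nonneg_nonpos)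
  finally show ?thesis
    using sol by (simp add: forward_solution_def)
qed

text \<open>The minimum is only relative to \<open>M\<close>, so the full gradient of
  \<open>H\<close> at \<open>xs\<close> need not vanish; the argument therefore uses a solution
  starting at \<open>xs\<close> instead of a critical point condition.\<close>

lemma equilibrium_strict_local_min:
  fixes X :: "'a::real_normed_vector \<Rightarrow> 'a" and H :: "'a \<Rightarrow> real"
  assumes inv: "forward_invariant X M"
    and decr: "\<And>x0 x t. forward_solution X x0 x \<Longrightarrow> 0 \<le> t \<Longrightarrow> H (x t) \<le> H x0"
    and xs: "xs \<in> M"
    and r: "r > 0" "\<And>y. y \<in> M \<Longrightarrow> dist xs y \<le> r \<Longrightarrow> y \<noteq> xs \<Longrightarrow> H xs < H y"
  shows "X xs = 0"
proof -
  obtain x where sol: "forward_solution X xs x" and x: "\<And>t. 0 \<le> t \<Longrightarrow> x t \<in> M"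
    using inv xs unfolding forward_invariant_def by blast
  have "\<exists>d>0. \<forall>t\<in>{0..}. dist t 0 < d \<longrightarrow> dist (x t) (x 0) < r"
    using forward_solution_continuous_on[OF sol] r(1) unfolding continuous_on_iff by force
  then obtain d where d: "d > 0" "\<And>t. 0 \<le> t \<Longrightarrow> t < d \<Longrightarrow> dist (x t) xs < r"
    using sol by (auto simp: forward_solution_def)
  have const: "x t = xs" if "0 \<le> t" "t < d" for t
  proof (rule ccontr)
    assume "x t \<noteq> xs"
    then have "H xs < H (x t)"
      using r(2)[OF x[OF that(1)]] d(2)[OF that] by (simp add: dist_commute)
    then show False
      using decr[OF sol that(1)] by simp
  qed
  have "(x has_vector_derivative X xs) (at 0 within {0..})"
    using sol unfolding forward_solution_def by auto
  \<comment> \<open>On \<open>{0..d/2}\<close> the solution is constant, so it has the two one-sided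
    derivatives \<open>X xs\<close> and \<open>0\<close> at time 0. They agree because the interval
    is nondegenerate.\<close>
  then have "(x has_vector_derivative X xs) (at 0 within {0..d/2})"
    by (rule has_vector_derivative_within_subset) auto
  moreover have "(x has_vector_derivative 0) (at 0 within {0..d/2})"
    by (rule has_vector_derivative_transform[where f = "\<lambda>_. xs"])
      (use d(1) const in auto)
  ultimately show ?thesis
    using vector_derivative_unique_within_closed_interval[of 0 "d/2" 0 x] d(1) by auto
qed

lemma stable_strict_local_min:
  fixes X :: "'a::euclidean_space \<Rightarrow> 'a" and H :: "'a \<Rightarrow> real"
  assumes inv: "forward_invariant X M"
    and decr: "\<And>x0 x t. forward_solution X x0 x \<Longrightarrow> 0 \<le> t \<Longrightarrow> H (x t) \<le> H x0"
    and cont: "continuous_on UNIV H"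
    and M: "closed M" "xs \<in> M"
    and min: "strict_local_min_in M H xs"
  shows "stable_equilibrium_in M X xs"
proof -
  have nbhd_ball: "\<exists>r>0. M \<inter> cball xs r \<subseteq> U" if U: "nbhd_in M xs U" for U
  proof -
    obtain W where W: "openin (top_of_set M) W" "xs \<in> W" "W \<subseteq> U"
      using U unfolding nbhd_in_def by blast
    then obtain r where "r > 0" "cball xs r \<inter> M \<subseteq> W"
      unfolding openin_contains_cball by blast
    then show ?thesis
      using W(3) by (auto simp: Int_commute)
  qed
  obtain r0 where r0: "r0 > 0" "\<And>y. y \<in> M \<Longrightarrow> dist xs y \<le> r0 \<Longrightarrow> y \<noteq> xs \<Longrightarrow> H xs < H y"
  proof -
    obtain U where U: "nbhd_in M xs U" "\<forall>y\<in>U. y \<noteq> xs \<longrightarrow> H xs < H y"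
      using min unfolding strict_local_min_in_def by blast
    obtain r where "r > 0" "M \<inter> cball xs r \<subseteq> U"
      using nbhd_ball[OF U(1)] by blast
    then show thesis
      using U(2) by (intro that[of r]) auto
  qed
  have "\<exists>V. nbhd_in M xs V \<and> V \<subseteq> U \<and>
      (\<forall>x0\<in>V. \<forall>x. forward_solution X x0 x \<longrightarrow> (\<forall>t\<ge>0. x t \<in> U))" if U: "nbhd_in M xs U" for U
  proof -
    obtain r1 where r1: "r1 > 0" "M \<inter> cball xs r1 \<subseteq> U"
      using nbhd_ball[OF U] by blast
    \<comment> \<open>A radius small enough both for strictness of the minimum and for the ball in
      \<open>M\<close> to stay inside \<open>U\<close>.\<close>
    define r where "r = min r0 r1"
    have r: "r > 0" "M \<inter> cball xs r \<subseteq> U"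
      "\<And>y. y \<in> M \<Longrightarrow> dist xs y \<le> r \<Longrightarrow> y \<noteq> xs \<Longrightarrow> H xs < H y"
      using r0 r1 by (auto simp: r_def)
    \<comment> \<open>The energy barrier. If \<open>M\<close> misses the sphere, for instance when
      \<open>xs\<close> is isolated in \<open>M\<close>, any level above \<open>H xs\<close>
      serves.\<close>
    have "\<exists>m. H xs < m \<and> (\<forall>y\<in>M \<inter> sphere xs r. m \<le> H y)"
    proof (cases "M \<inter> sphere xs r = {}")
      case True
      then show ?thesis
        using gt_ex[of "H xs"] by auto
    next
      case False
      have "compact (M \<inter> sphere xs r)"
        using M(1) by (simp add: closed_Int_compact)
      then obtain z where z: "z \<in> M \<inter> sphere xs r" "\<forall>y\<in>M \<inter> sphere xs r. H z \<le> H y"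
        using continuous_attains_inf[OF _ False] cont continuous_on_subset by blast
      have "H xs < H z"
        using z(1) r(1) by (intro r(3)) auto
      then show ?thesis
        using z(2) by blast
    qed
    then obtain m where m: "H xs < m" "\<And>y. y \<in> M \<Longrightarrow> dist xs y = r \<Longrightarrow> m \<le> H y"
      by auto
    define V where "V = M \<inter> (ball xs r \<inter> {y. H y < m})"
    have "open {y. H y < m}"
      using cont by (intro open_Collect_less) auto
    then have "openin (top_of_set M) V"
      unfolding V_def by (auto intro!: openin_open_Int)
    then have "nbhd_in M xs V"
      unfolding nbhd_in_def using M(2) r(1) m(1) by (auto simp: V_def)
    moreover have "V \<subseteq> U"
      using r(2) by (auto simp: V_def)
    moreover have "x t \<in> U" if x0: "x0 \<in> V" and sol: "forward_solution X x0 x" and t: "0 \<le> t"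
      for x0 x t
    proof -
      have xM: "x s \<in> M" if "0 \<le> s" for s
        using inv x0 sol that unfolding forward_invariant_def V_def by blast
      have "dist xs (x t) \<le> r"
      proof (rule ccontr)
        assume far: "\<not> dist xs (x t) \<le> r"
        have near: "dist xs (x 0) \<le> r"
          using x0 sol by (simp add: V_def forward_solution_def)
        have "continuous_on {0..t} (\<lambda>s. dist xs (x s))"
          by (intro continuous_intros continuous_on_subset[OF forward_solution_continuous_on[OF sol]])
            auto
        \<comment> \<open>A solution that gets farther than \<open>r\<close> must be at distance
          exactly \<open>r\<close> at some time \<open>s\<close>, where its energy is at least
          \<open>m\<close>, although it started below \<open>m\<close>.\<close>
        then obtain s where s: "0 \<le> s" "dist xs (x s) = r"
          using IVT'[of "\<lambda>s. dist xs (x s)" 0 r t] near far t by auto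
        have "m \<le> H (x s)"
          using m(2) xM s by blast
        also have "\<dots> \<le> H x0"
          using decr[OF sol s(1)] .
        finally show False
          using x0 by (simp add: V_def)
      qed
      then show ?thesis
        using r(2) xM[OF t] by auto
    qed
    ultimately show ?thesis
      by blast
  qed
  moreover have "X xs = 0"
    by (rule equilibrium_strict_local_min[where H = H and r = r0 and M = M])
      (use inv decr M(2) r0 in blast)+
  ultimately show ?thesis
    unfolding stable_equilibrium_in_def equilibrium_def by blast
qed

theorem theorem4p7:
  fixes H :: "'n::finite phase \<Rightarrow> real"
    and XF :: "'n phase \<Rightarrow> 'n phase"
    and M :: "'n phase set"
    and xs :: "'n phase"
  assumes "smooth H"
    and "dissipative_vf H XF"
    and "closed M"
    and "forward_invariant (\<lambda>x. hamiltonian_vf H x + XF x) M"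
    and "xs \<in> M"
    and "strict_local_min_in M (restrict H M) xs"
  shows "stable_equilibrium_in M (\<lambda>x. hamiltonian_vf H x + XF x) xs"
proof -
  have "C_k 0 H" and "C_k (Suc 0) H"
    using assms(1) unfolding smooth_def by blast+
  then have cont: "continuous_on UNIV H"
    and der: "\<And>y. (H has_derivative frechet_derivative H (at y)) (at y)"
    by (auto simp: frechet_derivative_works)
  \<comment> \<open>The Hamiltonian summand contributes zero, so the sign comes from dissipativity
    of \<open>XF\<close> alone.\<close>
  have "frechet_derivative H (at y) (hamiltonian_vf H y + XF y) \<le> 0" for y
  proof -
    have "frechet_derivative H (at y) (XF y) \<le> 0"
      using assms(2) unfolding dissipative_vf_def by blast
    then show ?thesis
      using derivative_hamiltonian_vf[OF der, of y]
        linear_add[OF has_derivative_linear[OF der[of y]], of "hamiltonian_vf H y" "XF y"] by linarith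
  qed
  then have "H (x t) \<le> H x0"
    if "forward_solution (\<lambda>x. hamiltonian_vf H x + XF x) x0 x" "0 \<le> t" for x0 x t
    using nonincreasing_along_forward_solution[OF that(1) der _ that(2)] by blast
  \<comment> \<open>\<open>restrict H M\<close> agrees with \<open>H\<close> only on
    \<open>M\<close>; this suffices because neighbourhoods in \<open>M\<close> are subsets of
    \<open>M\<close>.\<close>
  moreover have "strict_local_min_in M H xs"
  proof -
    obtain U where U: "nbhd_in M xs U" "\<forall>y\<in>U. y \<noteq> xs \<longrightarrow> restrict H M xs < restrict H M y"
      using assms(6) unfolding strict_local_min_in_def by blast
    have "U \<subseteq> M"
      using U(1) by (simp add: nbhd_in_def)
    then have "\<forall>y\<in>U. y \<noteq> xs \<longrightarrow> H xs < H y"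
      using U(2) assms(5) by (metis restrict_apply' subsetD)
    then show ?thesis
      using U(1) unfolding strict_local_min_in_def by blast
  qed
  ultimately show ?thesis
    using stable_strict_local_min assms(3-5) cont by blast
qed

end
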